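(* Consider the following game. Players stand in a line; the player at the front throws a dart, whose distance to the center is uniform on $[0,1]$ and independent of all other throws. If the distance is strictly smaller than the current distance to beat $x$, the player moves to the back of the line and the distance to beat becomes the distance of this throw; otherwise the player is eliminated. The game ends when one player remains. For $p\ge1$, $n\ge0$, $x\in[0,1]$, let $Q_{n,p}(x)$ be the probability that, starting with $p$ players remaining and distance to beat $x$, the game ends after exactly $n$ further throws. Then $$Q(x,u,z):=\sum_{n\ge0,\ p\ge1}Q_{n,p}(x)\,u^pz^n=\frac{u}{1-u}+\left(\frac{u}{1-uz}-\frac{u}{1-u}\right)\left(\frac{1-uz}{1-(1-x)uz}\right)^{1-1/u}.$$ *)

theory Defs
  imports "HOL-Probability.Probability"
begin

text \<open>
  A state of the game consists of the line of remaining players (front player first) and the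
  current distance to beat.  The players' names are irrelevant to the outcome; they are
  natural numbers.
\<close>

type_synonym dart_state = "nat list \<times> real"

fun dart_throw :: "real \<Rightarrow> dart_state \<Rightarrow> dart_state" where
  "dart_throw d (a # as, x) = (if d < x then (as @ [a], d) else (as, x))"
| "dart_throw d ([], x) = ([], x)"

text \<open>
  \<open>t k\<close> is the distance to the center of the \<open>k\<close>-th throw, counted from \<open>0\<close>.  The recursion
  does not stop when a single player remains; the continuation past that point is
  irrelevant, since \<open>dart_ends_after\<close> only looks at the first such time.
\<close>

primrec dart_state_after :: "(nat \<Rightarrow> real) \<Rightarrow> dart_state \<Rightarrow> nat \<Rightarrow> dart_state" where
  "dart_state_after t s 0 = s"
| "dart_state_after t s (Suc n) = dart_throw (t n) (dart_state_after t s n)"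

definition dart_ends_after :: "(nat \<Rightarrow> real) \<Rightarrow> dart_state \<Rightarrow> nat \<Rightarrow> bool" where
  "dart_ends_after t s n \<longleftrightarrow>
     length (fst (dart_state_after t s n)) = 1 \<and>
     (\<forall>m<n. length (fst (dart_state_after t s m)) \<noteq> 1)"

definition uniform_throws :: "'a measure \<Rightarrow> (nat \<Rightarrow> 'a \<Rightarrow> real) \<Rightarrow> bool" where
  "uniform_throws M T \<longleftrightarrow>
     prob_space M \<and>
     prob_space.indep_vars M (\<lambda>_. borel) T UNIV \<and>
     (\<forall>k. distr M borel (T k) = uniform_measure lborel {0..1})"

definition dart_prob ::
  "'a measure \<Rightarrow> (nat \<Rightarrow> 'a \<Rightarrow> real) \<Rightarrow> nat \<Rightarrow> nat \<Rightarrow> real \<Rightarrow> real" where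
  "dart_prob M T n p x =
     measure M {\<omega> \<in> space M. dart_ends_after (\<lambda>k. T k \<omega>) ([0..<p], x) n}"

end

theory Submission
  imports Defs
begin

text \<open>
  The players only matter through their number, and a player is lost exactly at a throw that does
  not beat the current distance.  Hence, with \<open>N n\<close> the number of such misses among the first
  \<open>n\<close> throws, the game with \<open>p\<close> players ends after \<open>n\<close> throws iff \<open>p = N n + 1\<close> and the last
  throw was a miss.  Summing over \<open>p\<close>, the coefficient of \<open>z ^ Suc n\<close> is
  \<open>u\<^sup>2 / (u - 1) * (g (Suc n) - g n)\<close> where \<open>g n = E (u ^ N n)\<close>.  Conditioning on the first throw
  gives \<open>g (Suc n) x = (1 - x) * u * g n x + (integral of g n over [0, x])\<close>, which is solved by the
  coefficients of the product of binomial series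
  \<open>(1 - u z) powr (- 1 / u) * (1 - (1 - x) u z) powr (1 / u - 1)\<close>.  The double series converges
  absolutely because the game ends after \<open>n\<close> throws with probability at most \<open>P (N n = p - 1)\<close>,
  and the binomial series converge absolutely also for \<open>\<bar>u\<bar>\<close> and \<open>\<bar>z\<bar>\<close> in place of \<open>u\<close> and \<open>z\<close>.
\<close>

section \<open>Counting misses along a fixed sequence of throws\<close>

fun to_beat :: "(nat \<Rightarrow> real) \<Rightarrow> real \<Rightarrow> nat \<Rightarrow> real" where
  "to_beat t x 0 = x"
| "to_beat t x (Suc n) = (if t n < to_beat t x n then t n else to_beat t x n)"

text \<open>The count goes on after the line would be empty, so one process serves every number of
  players at once.\<close>

fun misses :: "(nat \<Rightarrow> real) \<Rightarrow> real \<Rightarrow> nat \<Rightarrow> nat" where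
  "misses t x 0 = 0"
| "misses t x (Suc n) = (if t n < to_beat t x n then misses t x n else Suc (misses t x n))"

lemma to_beat_shift:
  "to_beat t x (Suc n) = to_beat (\<lambda>k. t (Suc k)) (if t 0 < x then t 0 else x) n"
  by (induction n) auto

text \<open>The recursion peels off the last throw; conditioning on the first throw calls for
  peeling at the other end.\<close>

lemma misses_shift:
  "misses t x (Suc n) =
     (if t 0 < x then misses (\<lambda>k. t (Suc k)) (t 0) n else Suc (misses (\<lambda>k. t (Suc k)) x n))"
proof (induction n)
  case (Suc n)
  then show ?case using to_beat_shift[of t x n] by (simp del: to_beat.simps)
qed auto

lemma misses_mono: "m \<le> n \<Longrightarrow> misses t x m \<le> misses t x n"
  by (rule lift_Suc_mono_le) auto

lemma misses_le: "misses t x n \<le> n"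
  by (induction n) auto

text \<open>The hypothesis keeps the line nonempty through time \<open>n\<close>, so every miss so
  far has removed a player; an empty line would no longer change while \<open>misses\<close> and
  \<open>to_beat\<close> go on.\<close>

lemma dart_state_after_misses:
  assumes "misses t x n < length as"
  shows "length (fst (dart_state_after t (as, x) n)) = length as - misses t x n
       \<and> snd (dart_state_after t (as, x) n) = to_beat t x n"
  using assms
proof (induction n)
  case (Suc n)
  have lt: "misses t x n < length as"
    using Suc.prems by (auto split: if_splits)
  obtain bs y where s: "dart_state_after t (as, x) n = (bs, y)"
    by fastforce
  with Suc.IH[OF lt] lt obtain c cs where "bs = c # cs"
    by (cases bs) auto
  with s Suc.IH[OF lt] Suc.prems lt show ?case
    by (auto split: if_splits)
qed auto

text \<open>A discrete intermediate value argument: the count starts at 0 and rises by at most one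
  per throw.\<close>

lemma misses_attains:
  assumes "k \<le> misses t x n"
  shows "\<exists>m\<le>n. misses t x m = k"
  using assms
proof (induction n)
  case (Suc n)
  then show ?case
    by (cases "k \<le> misses t x n") (auto split: if_splits intro: le_SucI)
qed auto

text \<open>One player remains when the count is \<open>p - 1\<close>; as the count is monotone,
  \<open>n\<close> is the first such time iff the last throw raised it. The case
  \<open>n = 0\<close> is the game that starts with a single player.\<close>

lemma dart_ends_after_iff:
  assumes "p \<ge> 1"
  shows "dart_ends_after t ([0..<p], x) n \<longleftrightarrow>
           p = Suc (misses t x n) \<and> (n = 0 \<or> misses t x (n - 1) < misses t x n)"
proof (cases "misses t x n < p")
  case True
  have len: "length (fst (dart_state_after t ([0..<p], x) m)) = p - misses t x m" if "m \<le> n" for m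
    using dart_state_after_misses[of t x m "[0..<p]"] misses_mono[OF that, of t x] True by simp
  have "(\<forall>m<n. misses t x m < misses t x n) \<longleftrightarrow> (n = 0 \<or> misses t x (n - 1) < misses t x n)"
  proof (cases n)
    case (Suc k)
    have "misses t x m \<le> misses t x k" if "m < n" for m
      using that Suc by (intro misses_mono) auto
    then show ?thesis using Suc by (force simp del: misses.simps)
  qed auto
  moreover have "dart_ends_after t ([0..<p], x) n \<longleftrightarrow>
      p = Suc (misses t x n) \<and> (\<forall>m<n. misses t x m < misses t x n)"
  proof -
    have "p - misses t x n = 1 \<longleftrightarrow> p = Suc (misses t x n)"
      using True by auto
    moreover have "p - misses t x m \<noteq> 1 \<longleftrightarrow> misses t x m < misses t x n"
      if "m < n" "p = Suc (misses t x n)" for m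
      using misses_mono[of m n t x] that by auto
    ultimately show ?thesis
      unfolding dart_ends_after_def using len by auto
  qed
  ultimately show ?thesis by simp
next
  case False
  \<comment> \<open>The count has already passed \<open>p - 1\<close>, so it took this value at some
    earlier time \<open>m\<close>, and the game was over before \<open>n\<close>.\<close>
  obtain m where m: "m \<le> n" "misses t x m = p - 1"
    using misses_attains[of "p - 1" t x n] False by (meson leI diff_le_self order_trans)
  have "m \<noteq> n" using m False assms by auto
  moreover have "length (fst (dart_state_after t ([0..<p], x) m)) = 1"
    using dart_state_after_misses[of t x m "[0..<p]"] m assms by simp
  ultimately show ?thesis
    using False m unfolding dart_ends_after_def by (auto simp: le_less)
qed

section \<open>Measurability and the joint law of the throws\<close>

lemma measurable_to_beat [measurable (raw)]:
  assumes [measurable]: "f \<in> N \<rightarrow>\<^sub>M (\<Pi>\<^sub>M i\<in>UNIV. borel)" "g \<in> borel_measurable N"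
  shows "(\<lambda>w. to_beat (f w) (g w) n) \<in> borel_measurable N"
  by (induction n) simp_all

lemma measurable_misses [measurable (raw)]:
  assumes [measurable]: "f \<in> N \<rightarrow>\<^sub>M (\<Pi>\<^sub>M i\<in>UNIV. borel)" "g \<in> borel_measurable N"
  shows "(\<lambda>w. misses (f w) (g w) n) \<in> N \<rightarrow>\<^sub>M count_space UNIV"
  by (induction n) simp_all

definition unif01 :: "real measure" where
  "unif01 = uniform_measure lborel {0..1}"

definition throw_seq :: "(nat \<Rightarrow> real) measure" where
  "throw_seq = (\<Pi>\<^sub>M i\<in>UNIV. unif01)"

lemma sets_unif01 [simp, measurable_cong]: "sets unif01 = sets borel"
  by (simp add: unif01_def)

lemma sets_throw_seq [simp, measurable_cong]: "sets throw_seq = sets (\<Pi>\<^sub>M i\<in>UNIV. borel)"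
  unfolding throw_seq_def by (intro sets_PiM_cong) auto

lemma space_throw_seq [simp]: "space throw_seq = UNIV"
  by (simp add: throw_seq_def space_PiM unif01_def)

lemma prob_space_unif01: "prob_space unif01"
  unfolding unif01_def by (intro prob_space_uniform_measure) auto

interpretation unif01: prob_space unif01
  by (rule prob_space_unif01)

interpretation throws: sequence_space unif01
  by unfold_locales

lemma prob_space_throw_seq: "prob_space throw_seq"
  unfolding throw_seq_def by (rule throws.prob_space_axioms)

interpretation throw_seq: prob_space throw_seq
  by (rule prob_space_throw_seq)

text \<open>Independence makes the joint law the product of the marginals; this moves the problem
  from an arbitrary \<open>M\<close> to one canonical sequence space.\<close>

lemma distr_throws:
  assumes "uniform_throws M T"
  shows "distr M (\<Pi>\<^sub>M i\<in>UNIV. borel) (\<lambda>\<omega> k. T k \<omega>) = throw_seq"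
proof -
  interpret prob_space M using assms by (simp add: uniform_throws_def)
  have ind: "indep_vars (\<lambda>_. borel) T UNIV" and d: "\<And>k. distr M borel (T k) = unif01"
    using assms by (auto simp: uniform_throws_def unif01_def)
  have rv: "T k \<in> borel_measurable M" for k
    using ind by (auto simp: indep_vars_def)
  have "distr M (\<Pi>\<^sub>M i\<in>UNIV. borel) (\<lambda>\<omega>. \<lambda>k\<in>UNIV. T k \<omega>) = (\<Pi>\<^sub>M k\<in>UNIV. distr M borel (T k))"
    using ind rv by (subst indep_vars_iff_distr_eq_PiM[symmetric]) auto
  then show ?thesis by (simp add: d throw_seq_def restrict_def)
qed

lemma sets_dart_ends_after:
  assumes "p \<ge> 1"
  shows "{t. dart_ends_after t ([0..<p], x) n} \<in> sets (\<Pi>\<^sub>M i\<in>UNIV. borel)"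
proof -
  let ?N = "\<Pi>\<^sub>M i\<in>(UNIV :: nat set). (borel :: real measure)"
  have m: "(\<lambda>t. misses t x m) \<in> ?N \<rightarrow>\<^sub>M count_space UNIV" for m
    by measurable
  have mb: "(\<lambda>t. misses t x m) \<in> borel_measurable ?N" for m
    by (rule measurable_compose[OF m]) simp
  have "Measurable.pred ?N (\<lambda>t. p = Suc (misses t x n))"
    by (rule measurable_compose[OF m]) simp
  moreover have "Measurable.pred ?N (\<lambda>t. misses t x (n - 1) < misses t x n)"
    unfolding pred_def by (rule borel_measurable_less[OF mb mb])
  ultimately have "Measurable.pred ?N (\<lambda>t. p = Suc (misses t x n) \<and>
      (n = 0 \<or> misses t x (n - 1) < misses t x n))"
    by (intro pred_intros_logic) simp_all
  then show ?thesis by (simp add: dart_ends_after_iff[OF assms] space_PiM pred_def)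
qed

lemma dart_prob_throw_seq:
  assumes "uniform_throws M T" and "p \<ge> 1"
  shows "dart_prob M T n p x = measure throw_seq {t. dart_ends_after t ([0..<p], x) n}"
proof -
  interpret prob_space M using assms by (simp add: uniform_throws_def)
  have [measurable]: "T k \<in> borel_measurable M" for k
    using assms by (auto simp: uniform_throws_def indep_vars_def)
  have "(\<lambda>\<omega> k. T k \<omega>) \<in> M \<rightarrow>\<^sub>M (\<Pi>\<^sub>M i\<in>UNIV. borel)"
    by (rule measurable_PiM_single') auto
  with sets_dart_ends_after[OF assms(2)] show ?thesis
    unfolding dart_prob_def distr_throws[OF assms(1), symmetric]
    by (subst measure_distr) (auto simp: vimage_def Int_def conj_commute)
qed

text \<open>Prepending an independent uniform throw to a sequence of throws reproduces the law of
  the sequence; Fubini then isolates the first throw, the bound \<open>B\<close> giving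
  integrability.\<close>

lemma integral_throw_seq_shift:
  fixes f :: "(nat \<Rightarrow> real) \<Rightarrow> complex"
  assumes f[measurable]: "f \<in> borel_measurable throw_seq" and b: "\<And>t. norm (f t) \<le> B"
  shows "(\<integral>t. f t \<partial>throw_seq) = (\<integral>s. (\<integral>t. f (case_nat s t) \<partial>throw_seq) \<partial>unif01)"
proof -
  interpret P: pair_prob_space unif01 throw_seq ..
  have m: "(\<lambda>(s, t). case_nat s t) \<in> unif01 \<Otimes>\<^sub>M throw_seq \<rightarrow>\<^sub>M throw_seq"
    unfolding throw_seq_def by measurable
  have "(\<integral>t. f t \<partial>throw_seq) = (\<integral>t. f t \<partial>distr (unif01 \<Otimes>\<^sub>M throw_seq) throw_seq (\<lambda>(s, t). case_nat s t))"
    using throws.PiM_iter by (simp add: throw_seq_def)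
  also have "\<dots> = (\<integral>st. f (case_nat (fst st) (snd st)) \<partial>(unif01 \<Otimes>\<^sub>M throw_seq))"
    using m by (subst integral_distr) (auto simp: case_prod_beta)
  also have "\<dots> = (\<integral>s. (\<integral>t. f (case_nat s t) \<partial>throw_seq) \<partial>unif01)"
  proof (subst P.integral_fst'[symmetric])
    have "(\<lambda>st. f (case_nat (fst st) (snd st))) \<in> borel_measurable (unif01 \<Otimes>\<^sub>M throw_seq)"
      using measurable_compose[OF m f] by (simp add: case_prod_beta)
    then show "integrable (unif01 \<Otimes>\<^sub>M throw_seq) (\<lambda>st. f (case_nat (fst st) (snd st)))"
      by (intro P.integrable_const_bound[where B = B]) (auto simp: b)
  qed simp
  finally show ?thesis .
qed

section \<open>Coefficients of a product of two binomial series\<close>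

text \<open>
  The coefficient of \<open>z ^ n\<close> in
  \<open>(1 - (1 - x) * u * z) powr (1 / u - 1) * (1 - u * z) powr (- (1 / u))\<close>.
\<close>

definition miss_gf :: "complex \<Rightarrow> nat \<Rightarrow> real \<Rightarrow> complex" where
  "miss_gf u n x = (- u) ^ n *
     (\<Sum>j\<le>n. ((1 / u - 1) gchoose j) * ((- (1 / u)) gchoose (n - j)) * of_real (1 - x) ^ j)"

lemma miss_gf_0 [simp]: "miss_gf u 0 x = 1"
  by (simp add: miss_gf_def)

text \<open>At \<open>x = 0\<close> both series have the same argument and exponents adding up to
  -1, so their product is geometric; on coefficients this is Vandermonde's identity.\<close>

lemma miss_gf_at_0: "miss_gf u n 0 = u ^ n"
proof -
  have "miss_gf u n 0 = (- u) ^ n * (\<Sum>j\<in>{0..n}. ((1 / u - 1) gchoose j) * ((- (1 / u)) gchoose (n - j)))"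
    by (simp add: miss_gf_def atMost_atLeast0)
  also have "\<dots> = (- u) ^ n * ((- 1) gchoose n)"
    by (subst gbinomial_Vandermonde) simp
  also have "((- 1 :: complex) gchoose n) = (- 1) ^ n"
    using gbinomial_minus[of "1::complex" n] by (simp add: binomial_gbinomial [symmetric] flip: of_nat_add)
  finally show ?thesis by (simp flip: power_mult_distrib)
qed

lemma continuous_on_miss_gf [continuous_intros]: "continuous_on A (miss_gf u n)"
  unfolding miss_gf_def by (intro continuous_intros)

lemma gbinomial_Suc_mult:
  fixes a :: complex
  shows "of_nat (Suc k) * (a gchoose Suc k) = (a - of_nat k) * (a gchoose k)"
  by (metis gbinomial_absorb_comp gbinomial_absorption)

text \<open>
  Differential form of the first-throw recurrence
  \<open>g (Suc n) x = (1 - x) * u * g n x + (integral of g n over [0, x])\<close>.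
\<close>

lemma miss_gf_deriv:
  assumes "u \<noteq> 0"
  shows "((\<lambda>y. miss_gf u (Suc n) y - of_real (1 - y) * u * miss_gf u n y)
           has_vector_derivative miss_gf u n x) (at x within A)"
proof -
  define b c where "b j = ((1 / u - 1) gchoose j)" and "c j = ((- (1 / u)) gchoose j)" for j :: nat
  have g: "miss_gf u n y = (- u) ^ n * (\<Sum>j\<le>n. b j * c (n - j) * of_real (1 - y) ^ j)" for n y
    by (simp add: miss_gf_def b_def c_def)
  \<comment> \<open>The subtracted term is absorbed into the second sum: \<open>- u\<close> raises
    the outer power and \<open>1 - y\<close> raises the inner one.\<close>
  have "((\<lambda>y. (- u) ^ Suc n * (\<Sum>j\<le>Suc n. b j * c (Suc n - j) * of_real (1 - y) ^ j) +
            (- u) ^ Suc n * (\<Sum>j\<le>n. b j * c (n - j) * of_real (1 - y) ^ Suc j))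
          has_vector_derivative miss_gf u n x) (at x within A)"
  proof (rule has_vector_derivative_eq_rhs)
    show "((\<lambda>y. (- u) ^ Suc n * (\<Sum>j\<le>Suc n. b j * c (Suc n - j) * of_real (1 - y) ^ j) +
            (- u) ^ Suc n * (\<Sum>j\<le>n. b j * c (n - j) * of_real (1 - y) ^ Suc j))
          has_vector_derivative
          (- u) ^ Suc n * (\<Sum>j\<le>Suc n. b j * c (Suc n - j) * (- of_nat j * of_real (1 - x) ^ (j - 1))) +
            (- u) ^ Suc n * (\<Sum>j\<le>n. b j * c (n - j) * (- of_nat (Suc j) * of_real (1 - x) ^ j))) (at x within A)"
    proof -
      have d: "((\<lambda>y. of_real (1 - y) ^ j) has_vector_derivative
          (- of_nat j * of_real (1 - x) ^ (j - 1) :: complex)) (at x within A)" for j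
      proof -
        have "((\<lambda>w. (1 - w) ^ j) has_field_derivative
                 (- of_nat j * (1 - of_real x) ^ (j - 1) :: complex)) (at (of_real x) within of_real ` A)"
          by (auto intro!: derivative_eq_intros)
        moreover have "(complex_of_real has_vector_derivative 1) (at x within A)"
          by (auto simp: has_vector_derivative_def scaleR_conv_of_real intro!: derivative_eq_intros)
        ultimately show ?thesis
          using field_vector_diff_chain_within[of complex_of_real 1 x A] by (fastforce simp: o_def)
      qed
      show ?thesis
        using d[of "Suc _"]
        by (intro has_vector_derivative_add has_vector_derivative_mult_right has_vector_derivative_sum d) simp
    qed
    have S: "(\<Sum>j\<le>Suc n. b j * c (Suc n - j) * (- of_nat j * of_real (1 - x) ^ (j - 1))) =
         (\<Sum>j\<le>n. c (n - j) * of_real (1 - x) ^ j * (- (of_nat (Suc j) * b (Suc j))))"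
      by (subst sum.atMost_Suc_shift) (auto intro!: sum.cong simp: algebra_simps)
    \<comment> \<open>Coefficientwise \<open>- (1 / u - 1 - j) - (j + 1) = - (1 / u)\<close>: the
      dependence on \<open>j\<close> cancels, and the remaining factor lowers
      \<open>(- u) ^ Suc n\<close> to \<open>(- u) ^ n\<close>.\<close>
    have "(\<Sum>j\<le>Suc n. b j * c (Suc n - j) * (- of_nat j * of_real (1 - x) ^ (j - 1))) +
       (\<Sum>j\<le>n. b j * c (n - j) * (- of_nat (Suc j) * of_real (1 - x) ^ j)) =
       (\<Sum>j\<le>n. (- (1 / u)) * (b j * c (n - j) * of_real (1 - x) ^ j))"
      unfolding S sum.distrib[symmetric]
    proof (rule sum.cong)
      fix j
      have "of_nat (Suc j) * b (Suc j) = (1 / u - 1 - of_nat j) * b j"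
        unfolding b_def by (rule gbinomial_Suc_mult)
      then show "c (n - j) * of_real (1 - x) ^ j * (- (of_nat (Suc j) * b (Suc j))) +
         b j * c (n - j) * (- of_nat (Suc j) * of_real (1 - x) ^ j) =
         (- (1 / u)) * (b j * c (n - j) * of_real (1 - x) ^ j)"
        by (simp only:) (simp add: algebra_simps)
    qed simp
    then show "(- u) ^ Suc n * (\<Sum>j\<le>Suc n. b j * c (Suc n - j) * (- of_nat j * of_real (1 - x) ^ (j - 1))) +
            (- u) ^ Suc n * (\<Sum>j\<le>n. b j * c (n - j) * (- of_nat (Suc j) * of_real (1 - x) ^ j)) = miss_gf u n x"
      using assms by (simp only: distrib_left[symmetric] sum_distrib_left[symmetric] g) simp
  qed
  also have "(\<lambda>y. (- u) ^ Suc n * (\<Sum>j\<le>Suc n. b j * c (Suc n - j) * of_real (1 - y) ^ j) +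
            (- u) ^ Suc n * (\<Sum>j\<le>n. b j * c (n - j) * of_real (1 - y) ^ Suc j)) =
       (\<lambda>y. miss_gf u (Suc n) y - of_real (1 - y) * u * miss_gf u n y)"
    by (rule ext) (simp add: g sum_distrib_left sum_negf mult_ac del: sum.atMost_Suc)
  finally show ?thesis .
qed

section \<open>Conditioning on the first throw\<close>

lemma integral_unif01:
  fixes f :: "real \<Rightarrow> complex"
  assumes [measurable]: "f \<in> borel_measurable borel"
  shows "(\<integral>s. f s \<partial>unif01) = (\<integral>s. indicator {0..1} s *\<^sub>R f s \<partial>lborel)"
proof -
  have u: "unif01 = density lborel (\<lambda>s. ennreal (indicator {0..1} s))"
    unfolding unif01_def uniform_measure_def by (auto intro!: density_cong simp: ennreal_indicator divide_ennreal_def)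
  show ?thesis unfolding u by (subst integral_density) auto
qed

text \<open>The shape of an expectation given the first throw \<open>s\<close>: a hit makes
  \<open>s\<close> the new threshold, a miss leaves a value independent of \<open>s\<close>. The
  first part is the fundamental theorem of calculus.\<close>

lemma integral_unif01_threshold:
  fixes h H :: "real \<Rightarrow> complex"
  assumes x: "0 \<le> x" "x \<le> 1" and h: "continuous_on UNIV h"
    and H: "\<And>y. (H has_vector_derivative h y) (at y)"
  shows "(\<integral>s. (if s < x then h s else c) \<partial>unif01) = H x - H 0 + of_real (1 - x) * c"
proof -
  have [measurable]: "h \<in> borel_measurable borel"
    using h by (rule borel_measurable_continuous_onI)
  have i1: "set_integrable lborel {0..x} h"
    using h by (intro borel_integrable_atLeastAtMost') (auto intro: continuous_on_subset)
  have I1: "(\<integral>s. indicator {0..x} s *\<^sub>R h s \<partial>lborel) = H x - H 0"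
    using x h H by (intro integral_FTC_atLeastAtMost)
      (auto intro: continuous_on_subset has_vector_derivative_at_within)
  have i2: "set_integrable lborel {x..1} (\<lambda>_. c)"
    by (intro borel_integrable_atLeastAtMost') auto
  have I2: "(\<integral>s. indicator {x..1} s *\<^sub>R c \<partial>lborel) = of_real (1 - x) * c"
    using x by (simp add: scaleR_conv_of_real)
  have "(\<integral>s. (if s < x then h s else c) \<partial>unif01) =
      (\<integral>s. indicator {0..1} s *\<^sub>R (if s < x then h s else c) \<partial>lborel)"
    by (rule integral_unif01) simp
  also have "\<dots> = (\<integral>s. indicator {0..x} s *\<^sub>R h s + indicator {x..1} s *\<^sub>R c \<partial>lborel)"
  proof (rule integral_cong_AE)
    \<comment> \<open>The closed intervals overlap only at \<open>x\<close>, a null set.\<close>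
    show "AE s in lborel. indicator {0..1} s *\<^sub>R (if s < x then h s else c) =
        indicator {0..x} s *\<^sub>R h s + indicator {x..1} s *\<^sub>R c"
      using AE_lborel_singleton[of x] by eventually_elim (use x in \<open>auto simp: indicator_def\<close>)
  qed simp_all
  also have "\<dots> = H x - H 0 + of_real (1 - x) * c"
    using i1 i2 by (subst Bochner_Integration.integral_add) (simp_all add: set_integrable_def I1 I2)
  finally show ?thesis .
qed

text \<open>Induction on \<open>n\<close> for all thresholds at once, since a hit changes the
  threshold; \<open>miss_gf_deriv\<close> supplies the antiderivative.\<close>

lemma expectation_misses:
  assumes "0 \<le> x" "x \<le> 1" "u \<noteq> 0"
  shows "(\<integral>t. u ^ misses t x n \<partial>throw_seq) = miss_gf u n x"
  using assms(1,2)
proof (induction n arbitrary: x)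
  case (Suc n)
  define B where "B = max 1 (norm u) ^ Suc n"
  have B: "norm (u ^ misses t x (Suc n)) \<le> B" for t
  proof -
    have "norm u ^ misses t x (Suc n) \<le> max 1 (norm u) ^ misses t x (Suc n)"
      by (intro power_mono) auto
    also have "\<dots> \<le> B"
      unfolding B_def by (intro power_increasing misses_le) auto
    finally show ?thesis by (simp add: norm_power)
  qed
  have "(\<integral>t. u ^ misses t x (Suc n) \<partial>throw_seq) =
     (\<integral>s. (\<integral>t. u ^ misses (case_nat s t) x (Suc n) \<partial>throw_seq) \<partial>unif01)"
    by (rule integral_throw_seq_shift[where B = B]) (use B in \<open>simp_all del: misses.simps\<close>)
  also have "\<dots> = (\<integral>s. (if s < x then (\<integral>t. u ^ misses t s n \<partial>throw_seq)
                          else u * (\<integral>t. u ^ misses t x n \<partial>throw_seq)) \<partial>unif01)"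
    by (intro Bochner_Integration.integral_cong) (simp_all add: misses_shift del: misses.simps)
  also have "\<dots> = (\<integral>s. (if s < x then miss_gf u n s else u * miss_gf u n x) \<partial>unif01)"
  proof (rule integral_cong_AE)
    \<comment> \<open>The induction hypothesis speaks of thresholds in [0, 1] only, where
      \<open>s\<close> lies almost surely.\<close>
    show "AE s in unif01. (if s < x then (\<integral>t. u ^ misses t s n \<partial>throw_seq)
              else u * (\<integral>t. u ^ misses t x n \<partial>throw_seq)) = (if s < x then miss_gf u n s else u * miss_gf u n x)"
      unfolding unif01_def by (intro AE_uniform_measureI AE_I2) (use Suc in auto)
    have "miss_gf u n \<in> borel_measurable borel"
      by (intro borel_measurable_continuous_onI continuous_on_miss_gf)
    then show "(\<lambda>s. if s < x then miss_gf u n s else u * miss_gf u n x) \<in> borel_measurable unif01"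
      by simp
  qed simp
  \<comment> \<open>By \<open>miss_gf_at_0\<close> the antiderivative vanishes at 0, and its
    subtracted term at \<open>x\<close> cancels the contribution of a miss.\<close>
  also have "\<dots> = (miss_gf u (Suc n) x - of_real (1 - x) * u * miss_gf u n x)
      - (miss_gf u (Suc n) 0 - of_real (1 - 0) * u * miss_gf u n 0) + of_real (1 - x) * (u * miss_gf u n x)"
    by (intro integral_unif01_threshold Suc.prems continuous_on_miss_gf miss_gf_deriv assms)
  also have "\<dots> = miss_gf u (Suc n) x"
    by (simp add: miss_gf_at_0)
  finally show ?case .
qed (use throw_seq.prob_space in simp)

section \<open>Branches of complex powers and convergence of the series\<close>

text \<open>Both logarithms have imaginary part below \<open>pi / 2\<close> in absolute value, so
  their difference stays in the principal strip.\<close>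

lemma powr_quotient_right_half_plane:
  fixes a b c :: complex
  assumes "Re a > 0" "Re b > 0"
  shows "(a / b) powr c = a powr c * b powr (- c)"
proof -
  have nz: "a \<noteq> 0" "b \<noteq> 0" using assms by auto
  have "\<bar>Im (Ln a)\<bar> < pi / 2" "\<bar>Im (Ln b)\<bar> < pi / 2"
    using assms Re_Ln_pos_lt[OF nz(1)] Re_Ln_pos_lt[OF nz(2)] by blast+
  then have "Im (Ln a - Ln b) \<in> {- pi<..pi}"
    by (auto simp: abs_less_iff)
  then have "Ln (exp (Ln a - Ln b)) = Ln a - Ln b"
    by (intro Ln_exp) auto
  then have "Ln (a / b) = Ln a - Ln b"
    using nz by (simp add: exp_diff)
  then show ?thesis
    using nz by (simp add: powr_def right_diff_distrib exp_diff exp_minus divide_inverse)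
qed

lemma summable_norm_gbinomial:
  fixes a w :: complex
  assumes "norm w < 1"
  shows "summable (\<lambda>n. norm ((a gchoose n) * w ^ n))"
proof -
  obtain r where r: "norm w < r" "r < 1" using dense[OF assms] by blast
  with norm_ge_zero[of w] have "r > 0" by linarith
  with r have "summable (\<lambda>n. (a gchoose n) * of_real r ^ n)"
    by (intro sums_summable[OF gen_binomial_complex]) simp
  then show ?thesis
    by (rule powser_insidea) (use r \<open>r > 0\<close> in simp)
qed

lemma summable_norm_Cauchy_product:
  fixes a b :: "nat \<Rightarrow> complex"
  assumes a: "summable (\<lambda>k. norm (a k))" and b: "summable (\<lambda>k. norm (b k))"
  shows "summable (\<lambda>k. norm (\<Sum>i\<le>k. a i * b (k - i)))"
proof (rule summable_comparison_test')
  show "summable (\<lambda>k. \<Sum>i\<le>k. norm (a i) * norm (b (k - i)))"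
    using a b by (intro sums_summable[OF Cauchy_product_sums]) simp_all
  show "norm (norm (\<Sum>i\<le>k. a i * b (k - i))) \<le> (\<Sum>i\<le>k. norm (a i) * norm (b (k - i)))" if "k \<ge> 0" for k
    by (simp add: sum_norm_le norm_mult)
qed

lemma norm_convex_less_1:
  fixes w :: complex
  assumes "0 \<le> x" "x \<le> 1" "norm w < 1"
  shows "norm (of_real (1 - x) * w) < 1"
proof -
  have "norm (of_real (1 - x) * w) = (1 - x) * norm w"
    using assms by (simp add: norm_mult del: of_real_diff)
  also have "\<dots> \<le> norm w"
    using assms by (intro mult_left_le_one_le) auto
  finally show ?thesis using assms by simp
qed

text \<open>\<open>miss_gf\<close> is by design the Cauchy product of the two binomial series, both
  absolutely convergent here.\<close>

lemma miss_gf_series: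
  assumes x: "0 \<le> x" "x \<le> 1" and w: "norm (u * z) < 1"
  shows "(\<lambda>n. miss_gf u n x * z ^ n) sums
           ((1 - of_real (1 - x) * (u * z)) powr (1 / u - 1) * (1 - u * z) powr (- (1 / u)))"
    and "summable (\<lambda>n. norm (miss_gf u n x * z ^ n))"
proof -
  define v where "v = of_real (1 - x) * (u * z)"
  have v: "norm v < 1"
    unfolding v_def by (rule norm_convex_less_1[OF x w])
  define a c where "a n = ((1 / u - 1) gchoose n) * (- v) ^ n"
    and "c n = (- (1 / u) gchoose n) * (- (u * z)) ^ n" for n
  have a: "a sums (1 - v) powr (1 / u - 1)" "summable (\<lambda>n. norm (a n))"
    unfolding a_def using gen_binomial_complex[of "- v"] summable_norm_gbinomial[of "- v"] v by auto
  have c: "c sums (1 - u * z) powr (- (1 / u))" "summable (\<lambda>n. norm (c n))"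
    unfolding c_def using gen_binomial_complex[of "- (u * z)"] summable_norm_gbinomial[of "- (u * z)"] w
    by auto
  have eq: "miss_gf u n x * z ^ n = (\<Sum>j\<le>n. a j * c (n - j))" for n
  proof -
    have "a j * c (n - j) = (- u) ^ n * (((1 / u - 1) gchoose j) * ((- (1 / u)) gchoose (n - j)) * of_real (1 - x) ^ j) * z ^ n"
      if "j \<le> n" for j
    proof -
      have "(- v) ^ j * (- (u * z)) ^ (n - j) = of_real (1 - x) ^ j * ((- (u * z)) ^ j * (- (u * z)) ^ (n - j))"
        unfolding v_def by (simp flip: power_mult_distrib)
      also have "(- (u * z)) ^ j * (- (u * z)) ^ (n - j) = (- u) ^ n * z ^ n"
        using that by (simp flip: power_add power_mult_distrib)
      finally show ?thesis
        unfolding a_def c_def by (simp add: mult_ac flip: power_mult_distrib)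
    qed
    then show ?thesis
      by (simp add: miss_gf_def sum_distrib_left sum_distrib_right)
  qed
  show "(\<lambda>n. miss_gf u n x * z ^ n) sums
           ((1 - of_real (1 - x) * (u * z)) powr (1 / u - 1) * (1 - u * z) powr (- (1 / u)))"
    using Cauchy_product_sums[OF a(2) c(2)] a(1) c(1) unfolding eq v_def[symmetric] by (simp add: sums_iff)
  show "summable (\<lambda>n. norm (miss_gf u n x * z ^ n))"
    unfolding eq by (rule summable_norm_Cauchy_product[OF a(2) c(2)])
qed

section \<open>Summing the ending probabilities over the number of players\<close>

text \<open>The counts are at most \<open>m\<close> and \<open>n\<close>, so every function of them
  is bounded. Two times occur because ending compares consecutive counts.\<close>

lemma integrable_throw_seq_misses:
  fixes f :: "nat \<Rightarrow> nat \<Rightarrow> complex"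
  shows "integrable throw_seq (\<lambda>t. f (misses t x m) (misses t x n))"
proof (rule throw_seq.integrable_const_bound)
  show "AE t in throw_seq. norm (f (misses t x m) (misses t x n)) \<le> (\<Sum>i\<le>m. \<Sum>j\<le>n. norm (f i j))"
  proof (rule AE_I2)
    fix t
    have "norm (f (misses t x m) (misses t x n)) \<le> (\<Sum>j\<le>n. norm (f (misses t x m) j))"
      by (rule member_le_sum) (auto simp: misses_le)
    also have "\<dots> \<le> (\<Sum>i\<le>m. \<Sum>j\<le>n. norm (f i j))"
      by (rule member_le_sum[where f = "\<lambda>i. \<Sum>j\<le>n. norm (f i j)"]) (auto simp: misses_le intro: sum_nonneg)
    finally show "norm (f (misses t x m) (misses t x n)) \<le> (\<Sum>i\<le>m. \<Sum>j\<le>n. norm (f i j))" .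
  qed
  have m: "(\<lambda>t. misses t x k) \<in> throw_seq \<rightarrow>\<^sub>M count_space UNIV" for k
    by measurable
  show "(\<lambda>t. f (misses t x m) (misses t x n)) \<in> borel_measurable throw_seq"
    by (rule measurable_compose_countable[OF _ m]) (rule measurable_compose[OF m], simp)
qed

text \<open>At most one player is lost per throw, so each sum over \<open>p\<close> is
  finite.\<close>

lemma dart_prob_eq_0:
  assumes "uniform_throws M T" and "p > Suc n"
  shows "dart_prob M T n p x = 0"
proof -
  have "{t. dart_ends_after t ([0..<p], x) n} = {}"
  proof -
    have "p \<noteq> Suc (misses t x n)" for t
      using assms(2) misses_le[of t x n] by linarith
    then show ?thesis
      using assms(2) by (simp add: dart_ends_after_iff)
  qed
  then show ?thesis using assms by (simp add: dart_prob_throw_seq)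
qed

text \<open>For a given sequence of throws only \<open>p = Suc (misses t x n)\<close> can end at
  time \<open>n\<close>, so under the integral the sum collapses to one term.\<close>

lemma sum_dart_prob:
  assumes "uniform_throws M T"
  shows "(\<Sum>p=1..Suc n. of_real (dart_prob M T n p x) * (v :: complex) ^ p) =
    (\<integral>t. (if n = 0 \<or> misses t x (n - 1) < misses t x n then v ^ Suc (misses t x n) else 0) \<partial>throw_seq)"
proof -
  let ?A = "\<lambda>p. {t. dart_ends_after t ([0..<p], x) n}"
  have A: "?A p \<in> sets throw_seq" if "p \<ge> 1" for p
    using sets_dart_ends_after[OF that] by simp
  have "(\<Sum>p=1..Suc n. of_real (dart_prob M T n p x) * v ^ p) =
        (\<Sum>p=1..Suc n. \<integral>t. indicator (?A p) t *\<^sub>R v ^ p \<partial>throw_seq)"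
    using A assms by (intro sum.cong) (simp_all add: dart_prob_throw_seq scaleR_conv_of_real)
  also have "\<dots> = (\<integral>t. (\<Sum>p=1..Suc n. indicator (?A p) t *\<^sub>R v ^ p) \<partial>throw_seq)"
    using A by (subst Bochner_Integration.integral_sum) (auto simp: throw_seq.emeasure_eq_measure)
  also have "\<dots> = (\<integral>t. (if n = 0 \<or> misses t x (n - 1) < misses t x n then v ^ Suc (misses t x n) else 0) \<partial>throw_seq)"
  proof (rule Bochner_Integration.integral_cong)
    fix t
    have "(\<Sum>p=1..Suc n. indicator (?A p) t *\<^sub>R v ^ p) =
      (\<Sum>p=1..Suc n. if p = Suc (misses t x n) then
         (if n = 0 \<or> misses t x (n - 1) < misses t x n then v ^ p else 0) else 0)"
      by (intro sum.cong) (auto simp: indicator_def dart_ends_after_iff)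
    also have "\<dots> = (if n = 0 \<or> misses t x (n - 1) < misses t x n then v ^ Suc (misses t x n) else 0)"
      using misses_le[of t x n] by (subst sum.delta) auto
    finally show "(\<Sum>p=1..Suc n. indicator (?A p) t *\<^sub>R v ^ p) = \<dots>" .
  qed simp
  finally show ?thesis .
qed

lemma sum_dart_prob_0:
  assumes "uniform_throws M T"
  shows "(\<Sum>p=1..Suc 0. of_real (dart_prob M T 0 p x) * (v :: complex) ^ p) = v"
  unfolding sum_dart_prob[OF assms] using throw_seq.prob_space by simp

lemma sum_dart_prob_Suc:
  assumes "uniform_throws M T" "0 \<le> x" "x \<le> 1" "u \<noteq> 0" "u \<noteq> 1"
  shows "(\<Sum>p=1..Suc (Suc n). of_real (dart_prob M T (Suc n) p x) * u ^ p) =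
    u\<^sup>2 / (u - 1) * (miss_gf u (Suc n) x - miss_gf u n x)"
proof -
  \<comment> \<open>The count \<open>k\<close> either stays, and both sides are 0, or becomes
    \<open>k + 1\<close>, and \<open>u ^ (k + 2)\<close> equals \<open>u^2 / (u - 1)\<close> times
    \<open>u ^ (k + 1) - u ^ k\<close>.\<close>
  have "(if misses t x n < misses t x (Suc n) then u ^ Suc (misses t x (Suc n)) else 0) =
        u\<^sup>2 / (u - 1) * (u ^ misses t x (Suc n) - u ^ misses t x n)" for t
    using assms by (simp add: field_simps power2_eq_square)
  then have "(\<Sum>p=1..Suc (Suc n). of_real (dart_prob M T (Suc n) p x) * u ^ p) =
     (\<integral>t. u\<^sup>2 / (u - 1) * (u ^ misses t x (Suc n) - u ^ misses t x n) \<partial>throw_seq)"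
    unfolding sum_dart_prob[OF assms(1)] by (simp del: misses.simps)
  also have "\<dots> = u\<^sup>2 / (u - 1) * ((\<integral>t. u ^ misses t x (Suc n) \<partial>throw_seq) - (\<integral>t. u ^ misses t x n \<partial>throw_seq))"
    using integrable_throw_seq_misses[of "\<lambda>i j. u ^ j" x 0 "Suc n"] integrable_throw_seq_misses[of "\<lambda>i j. u ^ j" x 0 n]
    by (subst integral_mult_right_zero, subst Bochner_Integration.integral_diff) simp_all
  also have "\<dots> = u\<^sup>2 / (u - 1) * (miss_gf u (Suc n) x - miss_gf u n x)"
    using assms by (simp add: expectation_misses del: misses.simps)
  finally show ?thesis .
qed

text \<open>Dropping the condition that the last throw is a miss avoids dividing by
  \<open>r - 1\<close>, so that \<open>r = 1\<close> is covered: \<open>norm u\<close> may be 1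
  although \<open>u\<close> is not.\<close>

lemma sum_dart_prob_le:
  assumes "uniform_throws M T" "0 \<le> x" "x \<le> 1" "r > 0"
  shows "(\<Sum>p=1..Suc n. dart_prob M T n p x * r ^ p) \<le> r * norm (miss_gf (of_real r) n x)"
proof -
  let ?F = "\<lambda>t. if n = 0 \<or> misses t x (n - 1) < misses t x n
              then (of_real r :: complex) ^ Suc (misses t x n) else 0"
  let ?G = "\<lambda>t. (of_real r :: complex) * of_real r ^ misses t x n"
  have F: "integrable throw_seq ?F"
    by (rule integrable_throw_seq_misses[of "\<lambda>i j. if n = 0 \<or> i < j then of_real r ^ Suc j else 0"])
  have G: "integrable throw_seq ?G"
    by (rule integrable_throw_seq_misses[of "\<lambda>i j. of_real r * of_real r ^ j"])
  have "(\<Sum>p=1..Suc n. dart_prob M T n p x * r ^ p) =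
     Re (\<Sum>p=1..Suc n. of_real (dart_prob M T n p x) * of_real r ^ p)"
    by (simp flip: of_real_power of_real_mult of_real_sum)
  also have "\<dots> = (\<integral>t. Re (?F t) \<partial>throw_seq)"
    unfolding sum_dart_prob[OF assms(1)] using F by (rule integral_Re[symmetric])
  also have "\<dots> \<le> (\<integral>t. Re (?G t) \<partial>throw_seq)"
    using F G assms by (intro integral_mono integrable_Re) (auto simp flip: of_real_power)
  also have "\<dots> = Re (\<integral>t. ?G t \<partial>throw_seq)"
    using G by (rule integral_Re)
  also have "\<dots> = Re (of_real r * miss_gf (of_real r) n x)"
    using assms by (simp add: expectation_misses)
  also have "\<dots> \<le> norm (of_real r * miss_gf (of_real r) n x)"
    by (rule complex_Re_le_cmod)
  also have "\<dots> = r * norm (miss_gf (of_real r) n x)"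
    using assms by (simp add: norm_mult)
  finally show ?thesis .
qed

text \<open>With \<open>G\<close> the series of \<open>miss_gf\<close>, the terms
  \<open>G - 1\<close> and \<open>z * G\<close> are its two shifts, and the summand \<open>u\<close>
  is the coefficient for \<open>n = 0\<close>.\<close>

lemma dart_gf_eq:
  fixes u z G :: complex
  assumes "1 - u * z \<noteq> 0" "u \<noteq> 1"
  shows "u\<^sup>2 / (u - 1) * ((G - 1) - z * G) + u =
    u / (1 - u) + (u / (1 - u * z) - u / (1 - u)) * ((1 - u * z) * G)"
proof -
  have nz: "1 - u \<noteq> 0" using assms by simp
  have "u\<^sup>2 / (u - 1) * ((G - 1) - z * G) = - (u\<^sup>2 * ((G - 1) - z * G)) / (1 - u)"
    by (metis minus_diff_eq minus_divide_divide minus_minus times_divide_eq_left)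
  moreover have "(u / (1 - u * z) - u / (1 - u)) * ((1 - u * z) * G) = u * G - u * (1 - u * z) * G / (1 - u)"
    by (subst left_diff_distrib) (use assms(1) in simp)
  ultimately show ?thesis
    using nz by (simp add: divide_simps) (simp add: algebra_simps power2_eq_square)
qed

section \<open>Assembling the double series\<close>

theorem theorem3p5:
  fixes M :: "'a measure" and T :: "nat \<Rightarrow> 'a \<Rightarrow> real"
    and x :: real and u z :: complex
  assumes "uniform_throws M T"
    and "0 \<le> x" and "x \<le> 1"
    and "u \<noteq> 0" and "u \<noteq> 1" and "norm (u * z) < 1"
  shows "((\<lambda>(n, p). of_real (dart_prob M T n p x) * u ^ p * z ^ n) has_sum
           (u / (1 - u) +
            (u / (1 - u * z) - u / (1 - u)) *
              ((1 - u * z) / (1 - (1 - of_real x) * u * z)) powr (1 - 1 / u)))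
         {(n, p). p \<ge> 1}"
proof -
  let ?f = "\<lambda>(n, p). of_real (dart_prob M T n p x) * u ^ p * z ^ n"
  define q where "q n = (\<Sum>p=1..Suc n. of_real (dart_prob M T n p x) * u ^ p)" for n
  define G where "G = (1 - of_real (1 - x) * (u * z)) powr (1 / u - 1) * (1 - u * z) powr (- (1 / u))"
  note x = assms(2,3) and w = assms(6)
  have fin: "(g has_sum sum g {1..Suc n}) {1..}"
    if "\<And>p. p > Suc n \<Longrightarrow> g p = 0" for g :: "nat \<Rightarrow> 'b :: {comm_monoid_add, topological_space}" and n
  proof -
    have "(g has_sum sum g {1..Suc n}) {1..Suc n}"
      by (rule has_sum_finite) simp
    then show ?thesis
      by (rule has_sum_cong_neutral[THEN iffD1, rotated -1]) (auto intro: that)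
  qed
  have inner: "((\<lambda>p. ?f (n, p)) has_sum q n * z ^ n) {1..}" for n
    using fin[of n "\<lambda>p. ?f (n, p)"] dart_prob_eq_0[OF assms(1)]
    by (simp add: q_def sum_distrib_right del: sum.cl_ivl_Suc)
  have innernorm: "((\<lambda>p. norm (?f (n, p))) has_sum (\<Sum>p=1..Suc n. norm (?f (n, p)))) {1..}" for n
    using dart_prob_eq_0[OF assms(1)] by (intro fin) simp
  \<comment> \<open>Probabilities are nonnegative, so taking norms gives the same sum at
    \<open>norm u\<close> and \<open>norm z\<close>.\<close>
  have le: "(\<Sum>p=1..Suc n. norm (?f (n, p))) \<le> norm u * norm (miss_gf (of_real (norm u)) n x * z ^ n)" for n
  proof -
    have "(\<Sum>p=1..Suc n. norm (?f (n, p))) = (\<Sum>p=1..Suc n. dart_prob M T n p x * norm u ^ p) * norm z ^ n"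
      by (simp add: norm_mult norm_power sum_distrib_right dart_prob_def del: sum.cl_ivl_Suc)
    also have "\<dots> \<le> (norm u * norm (miss_gf (of_real (norm u)) n x)) * norm z ^ n"
      using assms by (intro mult_right_mono sum_dart_prob_le) auto
    finally show ?thesis by (simp add: norm_mult norm_power mult_ac)
  qed
  have sn: "summable (\<lambda>n. norm u * norm (miss_gf (of_real (norm u)) n x * z ^ n))"
    using w by (intro summable_mult miss_gf_series(2) x) (simp add: norm_mult)
  have sums: "(\<lambda>n. q n * z ^ n) sums (u\<^sup>2 / (u - 1) * ((G - 1) - z * G) + u)"
  proof -
    have q0: "q 0 = u"
      unfolding q_def by (rule sum_dart_prob_0[OF assms(1)])
    have g: "(\<lambda>n. miss_gf u n x * z ^ n) sums G"
      unfolding G_def by (rule miss_gf_series(1)[OF x w])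
    then have "(\<lambda>n. miss_gf u (Suc n) x * z ^ Suc n) sums (G - 1)"
      by (subst sums_Suc_iff) simp
    with g have "(\<lambda>n. u\<^sup>2 / (u - 1) * (miss_gf u (Suc n) x * z ^ Suc n - z * (miss_gf u n x * z ^ n)))
        sums (u\<^sup>2 / (u - 1) * ((G - 1) - z * G))"
      by (intro sums_mult sums_diff)
    also have "(\<lambda>n. u\<^sup>2 / (u - 1) * (miss_gf u (Suc n) x * z ^ Suc n - z * (miss_gf u n x * z ^ n))) =
        (\<lambda>n. q (Suc n) * z ^ Suc n)"
      unfolding q_def sum_dart_prob_Suc[OF assms(1-5)] by (simp add: algebra_simps)
    finally show ?thesis
      using sums_Suc_iff[of "\<lambda>n. q n * z ^ n"] q0 by simp
  qed
  have Gval: "u\<^sup>2 / (u - 1) * ((G - 1) - z * G) + u =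
           (u / (1 - u) +
            (u / (1 - u * z) - u / (1 - u)) *
              ((1 - u * z) / (1 - (1 - of_real x) * u * z)) powr (1 - 1 / u))"
  proof -
    define v where "v = of_real (1 - x) * (u * z)"
    have "norm v < 1"
      unfolding v_def by (rule norm_convex_less_1[OF x w])
    then have "Re v < 1" "Re (u * z) < 1"
      using w complex_Re_le_cmod[of v] complex_Re_le_cmod[of "u * z"] by linarith+
    then have "((1 - u * z) / (1 - v)) powr (1 - 1 / u) =
        (1 - u * z) powr (1 - 1 / u) * (1 - v) powr (- (1 - 1 / u))"
      by (intro powr_quotient_right_half_plane) auto
    \<comment> \<open>\<open>G\<close> carries the exponent \<open>- (1 / u)\<close>, so one full
      power of \<open>1 - u * z\<close> is split off.\<close>
    also have "(1 - u * z) powr (1 - 1 / u) = (1 - u * z) * (1 - u * z) powr (- (1 / u))"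
      using w by (subst powr_add[of _ 1 "- (1 / u)", simplified, symmetric]) auto
    finally have R: "((1 - u * z) / (1 - v)) powr (1 - 1 / u) = (1 - u * z) * G"
      by (simp add: G_def v_def mult_ac)
    have "(1 - of_real x) * u * z = v"
      by (simp add: v_def)
    moreover have "1 - u * z \<noteq> 0"
      using w by auto
    ultimately show ?thesis
      using dart_gf_eq[of u z G] assms(5) R by simp
  qed
  have "summable (\<lambda>n. norm (q n * z ^ n))"
  proof (rule summable_comparison_test'[OF sn])
    fix n
    have "norm (q n * z ^ n) \<le> (\<Sum>p=1..Suc n. norm (?f (n, p)))"
      unfolding q_def sum_distrib_right by (rule order_trans[OF norm_sum]) simp
    from order_trans[OF this le[of n]]
    show "norm (norm (q n * z ^ n)) \<le> norm u * norm (miss_gf (of_real (norm u)) n x * z ^ n)"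
      by (simp only: real_norm_def abs_norm_cancel)
  qed
  with sums have outer: "((\<lambda>n. q n * z ^ n) has_sum (u\<^sup>2 / (u - 1) * ((G - 1) - z * G) + u)) UNIV"
    by (intro norm_summable_imp_has_sum)
  \<comment> \<open>\<open>inner\<close> and \<open>outer\<close> give only the iterated sum;
    absolute summability over pairs turns it into the unordered double sum.\<close>
  have "(\<lambda>y. norm (?f y)) summable_on Sigma UNIV (\<lambda>_. {1..})"
  proof (subst Infinite_Sum.abs_summable_on_Sigma_iff, intro conjI ballI)
    show "(\<lambda>p. norm (?f (n, p))) summable_on {1..}" for n
      using innernorm by (rule has_sum_imp_summable)
    have eq: "(\<Sum>\<^sub>\<infinity>p\<in>{1..}. norm (?f (n, p))) = (\<Sum>p=1..Suc n. norm (?f (n, p)))" for n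
      using innernorm by (rule infsumI)
    have "summable (\<lambda>n. norm (norm (\<Sum>p=1..Suc n. norm (?f (n, p)))))"
      by (rule summable_comparison_test'[OF sn]) (use le in \<open>simp add: sum_nonneg del: sum.cl_ivl_Suc\<close>)
    then show "(\<lambda>n. norm (\<Sum>\<^sub>\<infinity>p\<in>{1..}. norm (?f (n, p)))) summable_on UNIV"
      unfolding eq by (rule norm_summable_imp_summable_on)
  qed
  then have "(?f has_sum (u\<^sup>2 / (u - 1) * ((G - 1) - z * G) + u)) (Sigma UNIV (\<lambda>_. {1..}))"
    by (rule has_sum_SigmaI[OF inner outer abs_summable_summable])
  also have "Sigma UNIV (\<lambda>_. {1..}) = {(n :: nat, p :: nat). p \<ge> 1}"
    by auto
  finally show ?thesis unfolding Gval .
qed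

end
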